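(* Let $n,\ell$ be positive integers and let $\mathcal{C}=\big\{\big(u^{j}_{i}\big)_{i=1}^{2\ell+1} : j=1,\dots,n\big\}$ be a class of $n$ convex sequences with values in $\mathbb{R}_+$ satisfying the following two conditions for some number $u$: (i) $u^{j}_{\ell+1}=u$ for all $j\in\{1,\dots,n\}$, and (ii) $u$ is the minimum of all values of all the sequences, i.e. $\min\{u^j_i : 1\le j\le n,\ 1\le i\le 2\ell+1\}=u$. Let $S(V,E)$ be a regular spider graph with $2n$ legs, the length of each leg being $\ell$. Then the points (terms) of the sequences in $\mathcal{C}$ can be embedded into $V$ as vertex weights so as to make $S$ a star-convex graph.
   Context: $\mathbb{R}_+$ is the set of non-negative reals. A finite sequence $(u_i)_{i=1}^{m}$ is convex if $2u_i\le u_{i-1}+u_{i+1}$ for all $2\le i\le m-1$. A spider is a tree with exactly one vertex of degree greater than $2$ (the hub), all other internal vertices having degree exactly $2$. A leg is a maximal path from the hub to a leaf; its length is its number of edges. A spider is regular (balanced) if all its legs have equal length. A weighted graph $G(V,E,w)$ is a simple connected graph $G(V,E)$ with a vertex-weight function $w:V\to\mathbb{R}_+$. A path $x_0,\dots,x_k$ is weighted-monotone if $w(x_0)\le\cdots\le w(x_k)$ or $w(x_0)\ge\cdots\ge w(x_k)$. A weighted graph with at least one vertex of degree $1$ is star-convex if there exists a vertex $p\in V$ such that for every vertex $v$ of degree $1$ there is a weighted-monotone path connecting $p$ and $v$. *)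

theory Defs
  imports Complex_Main "HOL-Library.Sublist" "Graph_Theory.Graph_Theory"
begin

definition convex_seq :: "nat \<Rightarrow> (nat \<Rightarrow> real) \<Rightarrow> bool" where
  "convex_seq m a \<longleftrightarrow> (\<forall>i\<in>{2..m - 1}. 2 * a i \<le> a (i - 1) + a (i + 1))"

text \<open>
  Finite simple undirected graphs are symmetric loop-free pair digraphs (\<open>pair_graph\<close>): every
  undirected edge is represented by its two orientations. Hence the degree of a vertex is its
  out-degree, and every edge gives a closed walk with two arcs that \<open>pre_digraph.cycle\<close> accepts as
  a cycle. The predicate \<open>tree\<close> of the library therefore fails for every symmetric digraph with an
  arc; an undirected tree is a connected graph without cycles of at least three arcs.
\<close>

abbreviation degree :: "'v pair_pre_digraph \<Rightarrow> 'v \<Rightarrow> nat" where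
  "degree G v \<equiv> out_degree (with_proj G) v"

definition undirected_tree :: "'v pair_pre_digraph \<Rightarrow> bool" where
  "undirected_tree G \<longleftrightarrow> pair_graph G \<and> connected (with_proj G) \<and>
     \<not> (\<exists>p. pre_digraph.cycle (with_proj G) p \<and> 3 \<le> length p)"

definition spider :: "'v pair_pre_digraph \<Rightarrow> 'v \<Rightarrow> bool" where
  "spider G h \<longleftrightarrow> undirected_tree G \<and> {v \<in> pverts G. degree G v > 2} = {h} \<and>
     (\<forall>v\<in>pverts G. v \<noteq> h \<and> degree G v > 1 \<longrightarrow> degree G v = 2)"

definition leg :: "'v pair_pre_digraph \<Rightarrow> 'v \<Rightarrow> 'v list \<Rightarrow> bool" where
  "leg G h p \<longleftrightarrow> vpath p (with_proj G) \<and> hd p = h \<and> degree G (last p) = 1 \<and>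
     \<not> (\<exists>q. vpath q (with_proj G) \<and> strict_prefix p q)"

definition regular_spider :: "'v pair_pre_digraph \<Rightarrow> nat \<Rightarrow> nat \<Rightarrow> bool" where
  "regular_spider G k l \<longleftrightarrow>
     (\<exists>h. spider G h \<and> card {p. leg G h p} = k \<and> (\<forall>p. leg G h p \<longrightarrow> vwalk_length p = l))"

definition weighted_graph :: "'v pair_pre_digraph \<Rightarrow> ('v \<Rightarrow> real) \<Rightarrow> bool" where
  "weighted_graph G w \<longleftrightarrow>
     pair_graph G \<and> connected (with_proj G) \<and> (\<forall>v\<in>pverts G. 0 \<le> w v)"

definition weighted_monotone :: "('v \<Rightarrow> real) \<Rightarrow> 'v list \<Rightarrow> bool" where
  "weighted_monotone w p \<longleftrightarrow> sorted_wrt (\<le>) (map w p) \<or> sorted_wrt (\<ge>) (map w p)"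

definition star_convex :: "'v pair_pre_digraph \<Rightarrow> ('v \<Rightarrow> real) \<Rightarrow> bool" where
  "star_convex G w \<longleftrightarrow> weighted_graph G w \<and> (\<exists>v\<in>pverts G. degree G v = 1) \<and>
     (\<exists>p\<in>pverts G. \<forall>v\<in>pverts G. degree G v = 1 \<longrightarrow>
        (\<exists>xs. vpath xs (with_proj G) \<and> hd xs = p \<and> last xs = v \<and> weighted_monotone w xs))"

text \<open>
  The \<open>n\<close> sequences \<open>a 1, \<dots>, a n\<close> of length \<open>2 * l + 1\<close> share their middle term, so that together
  they have \<open>2 * n * l + 1\<close> points. The map \<open>f\<close> places the \<open>i\<close>-th term of the \<open>j\<close>-th sequence at the
  vertex \<open>f j i\<close>, which gets that term as its weight. Every vertex is used, two terms share a vertex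
  only if both are middle terms (and all middle terms do), and the terms of each sequence are laid
  out in order along a path of the graph.
\<close>

definition embeds_terms ::
  "nat \<Rightarrow> nat \<Rightarrow> (nat \<Rightarrow> nat \<Rightarrow> real) \<Rightarrow> 'v pair_pre_digraph \<Rightarrow> ('v \<Rightarrow> real) \<Rightarrow> (nat \<Rightarrow> nat \<Rightarrow> 'v) \<Rightarrow> bool"
where
  "embeds_terms n l a G w f \<longleftrightarrow>
     {f j i | j i. j \<in> {1..n} \<and> i \<in> {1..2 * l + 1}} = pverts G \<and>
     (\<forall>j\<in>{1..n}. \<forall>i\<in>{1..2 * l + 1}. \<forall>j'\<in>{1..n}. \<forall>i'\<in>{1..2 * l + 1}.
        f j i = f j' i' \<longleftrightarrow> (j = j' \<and> i = i') \<or> (i = l + 1 \<and> i' = l + 1)) \<and>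
     (\<forall>j\<in>{1..n}. vpath (map (f j) [1..<2 * l + 2]) (with_proj G)) \<and>
     (\<forall>j\<in>{1..n}. \<forall>i\<in>{1..2 * l + 1}. w (f j i) = a j i)"

end

theory Submission
  imports Defs
begin

text \<open>
  The legs of a spider cover its vertices and pairwise share only the hub. Pair the \<open>2n\<close> legs up;
  gluing the two legs of a pair at the hub gives \<open>n\<close> paths with \<open>2l + 1\<close> vertices each, all of which
  have the hub as their middle vertex and are otherwise disjoint. Writing the \<open>j\<close>-th sequence along
  the \<open>j\<close>-th path is consistent at the hub because all the middle terms equal \<open>u\<close>. A convex sequence
  that attains its minimum at the middle does not decrease when one walks away from the middle in
  either direction, so the weights are monotone along the path from the hub to any vertex, in
  particular to any leaf: the hub is the centre required for star-convexity.

  That the legs have this shape must be derived from the definition of a spider as a tree with a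
  single vertex of degree greater than two. A longest path from the hub through a given vertex ends
  in a leaf, since the tree has no cycle, and so it is a leg: this gives the covering
  (\<open>spider_vertex_on_leg\<close>). Two different legs can part only at a vertex of degree at least three,
  which is the hub, and after parting they cannot meet again without closing a cycle
  (\<open>spider_legs_meet_at_hub\<close>). The layout of the glued legs is \<open>regular_spider_layout\<close>, and the
  monotonicity is \<open>convex_seq_mono_right_of_min\<close> with its mirror image.
\<close>

section \<open>Paths in undirected trees\<close>

lemma vpath_with_proj_iff:
  "vpath p (with_proj G) \<longleftrightarrow>
     p \<noteq> [] \<and> set p \<subseteq> pverts G \<and> successively (\<lambda>x y. (x, y) \<in> parcs G) p \<and> distinct p"
proof -
  have "set (vwalk_arcs p) \<subseteq> parcs G \<longleftrightarrow> successively (\<lambda>x y. (x, y) \<in> parcs G) p"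
    by (induction p rule: vwalk_arcs.induct) auto
  then show ?thesis by (auto simp: vpath_def vwalk_def)
qed

lemma degree_eq_card_neighbours: "degree G v = card {x. (v, x) \<in> parcs G}"
proof -
  have "out_arcs (with_proj G) v = Pair v ` {x. (v, x) \<in> parcs G}"
    by (auto simp: out_arcs_def)
  then show ?thesis by (simp add: out_degree_def card_image inj_on_def)
qed

lemma pair_graph_arcD:
  assumes "pair_graph G" and "(x, y) \<in> parcs G"
  shows "x \<in> pverts G" and "y \<in> pverts G" and "(y, x) \<in> parcs G" and "x \<noteq> y"
proof -
  interpret pair_graph G by fact
  show "x \<in> pverts G" "y \<in> pverts G" using assms(2) wellformed' by auto
  show "(y, x) \<in> parcs G" using assms(2) graph_symmetric by simp
  show "x \<noteq> y" using pair_no_loops[OF assms(2)] by simp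
qed

lemma finite_neighbours:
  assumes "pair_graph G"
  shows "finite {x. (v, x) \<in> parcs G}"
proof -
  interpret pair_graph G by fact
  show ?thesis
    by (rule finite_subset[OF _ pair_finite_verts]) (auto dest: wellformed')
qed

lemma vpath_rev:
  assumes "pair_graph G" and "vpath p (with_proj G)"
  shows "vpath (rev p) (with_proj G)"
proof -
  have "successively (\<lambda>x y. (x, y) \<in> parcs G) p"
    using assms(2) by (simp add: vpath_with_proj_iff)
  then have "successively (\<lambda>x y. (y, x) \<in> parcs G) p"
    by (rule successively_mono) (rule pair_graph_arcD(3)[OF assms(1)])
  then show ?thesis using assms(2) by (auto simp: vpath_with_proj_iff)
qed

text \<open>
  Acyclicity is a condition on arc lists, whereas legs are vertex lists. This form of it, in terms
  of vertex lists, is the only one that the arguments about legs refer to.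
\<close>
lemma undirected_tree_no_closing_arc:
  assumes tree: "undirected_tree G" and p: "vpath p (with_proj G)" and len: "3 \<le> length p"
  shows "(last p, hd p) \<notin> parcs G"
proof
  assume closing: "(last p, hd p) \<in> parcs G"
  interpret pair_graph G using tree by (simp add: undirected_tree_def)
  have verts: "pawalk_verts (hd xs) (vwalk_arcs xs) = xs" if "xs \<noteq> []" for xs :: "'a list"
    using that by (induction xs rule: vwalk_arcs.induct) auto
  have cas: "pcas (hd xs) (vwalk_arcs xs) (last xs)" if "xs \<noteq> []" for xs :: "'a list"
    using that by (induction xs rule: vwalk_arcs.induct) auto
  let ?c = "p @ [hd p]"
  have ne: "p \<noteq> []" and dist: "distinct p" and sub: "set p \<subseteq> pverts G"
    and arcs: "set (vwalk_arcs p) \<subseteq> parcs G"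
    using p by (auto simp: vpath_def vwalk_def)
  have "hd ?c = hd p" using ne by simp
  then have v: "pawalk_verts (hd p) (vwalk_arcs ?c) = ?c"
    and c: "pcas (hd p) (vwalk_arcs ?c) (hd p)"
    using verts[of ?c] cas[of ?c] by auto
  have "set (vwalk_arcs ?c) \<subseteq> parcs G"
    using arcs closing ne by (simp add: set_vwalk_arcs_snoc)
  then have "awalk (hd p) (vwalk_arcs ?c) (hd p)"
    using ne sub c by (auto simp: awalk_def)
  moreover have "distinct (tl ?c)" using dist ne by (cases p) auto
  moreover have len_c: "length (vwalk_arcs ?c) = length p"
    using vwalk_length_simp[of ?c, unfolded vwalk_length_def] by simp
  ultimately have "cycle (vwalk_arcs ?c)"
    using v ne by (auto simp: cycle_def)
  then show False using tree len len_c by (auto simp: undirected_tree_def)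
qed

text \<open>
  If the paths met again, one could follow the first path to a vertex of the second and return
  along the second. Because the two paths leave their common start in different directions, this
  closed path would have at least three vertices.
\<close>
lemma undirected_tree_paths_disjoint:
  assumes tree: "undirected_tree G"
    and p: "vpath (h # y # ps) (with_proj G)" and q: "vpath (h # z # qs) (with_proj G)"
    and "y \<noteq> z"
  shows "set (y # ps) \<inter> set (z # qs) = {}"
proof (rule ccontr)
  assume "set (y # ps) \<inter> set (z # qs) \<noteq> {}"
  then have "\<exists>x\<in>set (z # qs). x \<in> set (y # ps)" by blast
  then obtain B x C where B: "z # qs = B @ x # C" and x: "x \<in> set (y # ps)"
    and first: "\<forall>b\<in>set B. b \<notin> set (y # ps)"
    using split_list_first_prop[of "z # qs" "\<lambda>x. x \<in> set (y # ps)"] by blast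
  obtain A D where A: "y # ps = A @ x # D" using split_list[OF x] by blast
  have graph: "pair_graph G" using tree by (simp add: undirected_tree_def)
  have "vpath (h # B @ x # C) (with_proj G)" using q B by simp
  then have hB: "vpath (h # B @ [x]) (with_proj G)"
    by (auto simp: vpath_with_proj_iff successively_append_iff successively_Cons hd_append)
  have "vpath (rev (h # B @ [x])) (with_proj G)" by (rule vpath_rev[OF graph hB])
  moreover have "vpath (h # A @ x # D) (with_proj G)" using p A by simp
  moreover have "set A \<inter> set B = {}" using first A by auto
  ultimately have "vpath (h # A @ [x] @ rev B) (with_proj G)"
    by (auto simp: vpath_with_proj_iff successively_append_iff successively_Cons hd_append)
  moreover have "3 \<le> length (h # A @ [x] @ rev B)"
    using A B \<open>y \<noteq> z\<close> by (cases A; cases B) auto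
  moreover have "(last (h # A @ [x] @ rev B), hd (h # A @ [x] @ rev B)) \<in> parcs G"
  proof -
    have "last (h # A @ [x] @ rev B) = z" using B by (cases B) auto
    moreover have "(h, z) \<in> parcs G" using q by (simp add: vpath_with_proj_iff)
    ultimately show ?thesis using pair_graph_arcD(3)[OF graph] by simp
  qed
  ultimately show False using undirected_tree_no_closing_arc[OF tree] by blast
qed

section \<open>Legs of a spider\<close>

text \<open>
  A longest extension of the path ends in a leaf: all neighbours of its last vertex lie on the path,
  and any of them except the predecessor would close a cycle. The hypothesis on \<open>h\<close> excludes the tree with
  one vertex, where \<open>[h]\<close> is a longest path but does not end in a vertex of degree one.
\<close>
lemma vpath_extends_to_leg:
  assumes tree: "undirected_tree G" and deg: "0 < degree G h"
    and p: "vpath p (with_proj G)" and h: "hd p = h"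
  obtains q where "leg G h q" and "prefix p q"
proof -
  have graph: "pair_graph G" using tree by (simp add: undirected_tree_def)
  interpret pair_graph G by fact
  let ?P = "\<lambda>q. vpath q (with_proj G) \<and> prefix p q"
  have bound: "length q < Suc (card (pverts G))" if "?P q" for q
  proof -
    have "card (set q) \<le> card (pverts G)"
      using that by (intro card_mono pair_finite_verts) (auto simp: vpath_with_proj_iff)
    moreover have "card (set q) = length q"
      using that by (simp add: vpath_with_proj_iff distinct_card)
    ultimately show ?thesis by simp
  qed
  have "?P p" using p by simp
  then have "\<exists>q. ?P q \<and> (\<forall>r. ?P r \<longrightarrow> length r \<le> length q)"
    by (rule ex_has_greatest_nat) (use bound in blast)
  then obtain q where q: "?P q" and max: "\<And>r. ?P r \<Longrightarrow> length r \<le> length q"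
    by metis
  have path: "vpath q (with_proj G)" and ne: "q \<noteq> []" using q by (auto simp: vpath_with_proj_iff)
  have hd: "hd q = h" using q h p by (auto simp: prefix_def vpath_with_proj_iff)
  have inside: "x \<in> set q" if "(last q, x) \<in> parcs G" for x
  proof (rule ccontr)
    assume "x \<notin> set q"
    with that path have "?P (q @ [x])"
      using q pair_graph_arcD(2)[OF graph that]
      by (auto simp: vpath_with_proj_iff successively_append_iff)
    from max[OF this] show False by simp
  qed
  have "degree G (last q) = 1"
  proof (cases "butlast q = []")
    case True
    then have single: "q = [h]" using ne hd by (cases q) (auto split: if_splits)
    have "{x. (h, x) \<in> parcs G} \<noteq> {}"
      using deg unfolding degree_eq_card_neighbours by (intro notI) simp
    then obtain x where "(h, x) \<in> parcs G" by blast
    then show ?thesis using inside[of x] pair_graph_arcD(4)[OF graph] single by auto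
  next
    case False
    define q' k m where "q' = butlast (butlast q)" and "k = last (butlast q)" and "m = last q"
    have "q = butlast q @ [m]" "butlast q = q' @ [k]"
      using ne False by (simp_all add: q'_def k_def m_def)
    then have q_eq: "q = q' @ [k, m]" by simp
    have "(m, k) \<in> parcs G"
      using path q_eq pair_graph_arcD(3)[OF graph]
      by (auto simp: vpath_with_proj_iff successively_append_iff)
    moreover have "x = k" if arc: "(m, x) \<in> parcs G" for x
    proof (rule ccontr)
      assume "x \<noteq> k"
      have "x \<in> set q" using inside arc m_def by simp
      moreover have "x \<noteq> m" using pair_graph_arcD(4)[OF graph arc] by simp
      ultimately have "x \<in> set q'" using q_eq \<open>x \<noteq> k\<close> by auto
      then obtain c d where "q' = c @ x # d" by (meson split_list)
      then have "q = c @ (x # d @ [k, m])" using q_eq by simp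
      with path have "vpath (x # d @ [k, m]) (with_proj G)"
        by (auto simp: vpath_with_proj_iff successively_append_iff)
      from undirected_tree_no_closing_arc[OF tree this] arc show False by simp
    qed
    ultimately have "{x. (m, x) \<in> parcs G} = {k}" by blast
    then have "degree G m = 1" unfolding degree_eq_card_neighbours by simp
    then show ?thesis unfolding m_def .
  qed
  moreover have "\<not> (\<exists>r. vpath r (with_proj G) \<and> strict_prefix q r)"
  proof
    assume "\<exists>r. vpath r (with_proj G) \<and> strict_prefix q r"
    then obtain r where r: "vpath r (with_proj G)" "strict_prefix q r" by blast
    then have "?P r"
      using q prefix_order.order_trans[of p q r] by (simp add: prefix_order.less_imp_le)
    from max[OF this] prefix_length_less[OF r(2)] show False by simp
  qed
  ultimately have "leg G h q" using path hd by (simp add: leg_def)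
  then show thesis using that q by blast
qed

lemma spider_vertex_on_leg:
  assumes sp: "spider G h" and v: "v \<in> pverts G"
  obtains q where "leg G h q" and "v \<in> set q"
proof -
  have tree: "undirected_tree G" and hub: "{v \<in> pverts G. degree G v > 2} = {h}"
    using sp by (auto simp: spider_def)
  have graph: "pair_graph G" using tree by (simp add: undirected_tree_def)
  interpret pair_graph G by fact
  have h: "h \<in> pverts G" "0 < degree G h" using hub by auto
  have "strongly_connected (mk_symmetric (with_proj G))"
    using tree by (simp add: undirected_tree_def connected_def)
  then have "h \<rightarrow>\<^sup>*\<^bsub>with_proj (mk_symmetric (with_proj G))\<^esub> v"
    using h v by (auto simp: strongly_connected_def)
  then have "h \<rightarrow>\<^sup>*\<^bsub>with_proj G\<^esub> v"
    using reachable_mk_symmetric_eq pair_sym_arcs by blast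
  then obtain p where p: "vpath p (with_proj G)" "hd p = h" "last p = v"
    using reachable_vpath_conv[of h v] by auto
  obtain q where q: "leg G h q" "prefix p q"
    using vpath_extends_to_leg[OF tree h(2) p(1,2)] .
  have "v \<in> set p" using p by (auto simp: vpath_with_proj_iff)
  then show thesis using q that[of q] set_mono_prefix[OF q(2)] by auto
qed

text \<open>
  Neither leg is a prefix of the other, since legs are maximal. The last vertex they share before
  they diverge has two successors on them; anywhere but at the hub it would also have a predecessor,
  hence degree at least three. So they diverge at the hub, and paths that diverge in a tree never
  meet again.
\<close>
lemma spider_legs_meet_at_hub:
  assumes sp: "spider G h" and p: "leg G h p" and q: "leg G h q" and "p \<noteq> q"
    and x: "x \<in> set p" "x \<in> set q"
  shows "x = h"
proof -
  have tree: "undirected_tree G" and hub: "{v \<in> pverts G. degree G v > 2} = {h}"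
    using sp by (auto simp: spider_def)
  have graph: "pair_graph G" using tree by (simp add: undirected_tree_def)
  have pp: "vpath p (with_proj G)" "hd p = h" and qq: "vpath q (with_proj G)" "hd q = h"
    using p q by (auto simp: leg_def)
  have "p \<parallel> q"
    using p q \<open>p \<noteq> q\<close> unfolding leg_def parallel_def strict_prefix_def by metis
  then obtain c y ps z qs where "y \<noteq> z" and p_eq: "p = c @ y # ps" and q_eq: "q = c @ z # qs"
    using parallel_decomp by blast
  have "c \<noteq> []" using p_eq q_eq pp(2) qq(2) \<open>y \<noteq> z\<close> by auto
  then obtain c' m where c: "c = c' @ [m]" by (metis append_butlast_last_id)
  have my: "(m, y) \<in> parcs G" and mz: "(m, z) \<in> parcs G"
    using pp qq p_eq q_eq c by (auto simp: vpath_with_proj_iff successively_append_iff)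
  have "c' = []"
  proof (rule ccontr)
    assume ne: "c' \<noteq> []"
    have k: "(m, last c') \<in> parcs G"
      using pp p_eq c ne pair_graph_arcD(3)[OF graph]
      by (auto simp: vpath_with_proj_iff successively_append_iff)
    have "last c' \<noteq> y" "last c' \<noteq> z"
      using pp qq p_eq q_eq c ne last_in_set[OF ne] by (auto simp: vpath_with_proj_iff)
    then have "card {last c', y, z} = 3" using \<open>y \<noteq> z\<close> by simp
    moreover have "card {last c', y, z} \<le> degree G m"
      unfolding degree_eq_card_neighbours
      by (rule card_mono[OF finite_neighbours[OF graph]]) (use k my mz in auto)
    ultimately have "m \<in> {v \<in> pverts G. degree G v > 2}"
      using pair_graph_arcD(1)[OF graph my] by simp
    then have "m = h" unfolding hub by simp
    moreover have "h \<in> set c'" using pp p_eq c ne by auto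
    ultimately show False using pp p_eq c by (auto simp: vpath_with_proj_iff)
  qed
  then have "p = h # y # ps" "q = h # z # qs" using p_eq q_eq c pp by auto
  then show ?thesis
    using undirected_tree_paths_disjoint[OF tree _ _ \<open>y \<noteq> z\<close>, of h ps qs] pp qq x by auto
qed

section \<open>Convex sequences\<close>

text \<open>
  The increment of a convex sequence just after a minimum is nonnegative, and by convexity the
  increments never decrease.
\<close>
lemma convex_seq_mono_right_of_min:
  assumes convex: "convex_seq m a" and c: "1 \<le> c"
    and min: "\<And>i. i \<in> {1..m} \<Longrightarrow> a c \<le> a i"
    and "c \<le> i" "i \<le> j" "j \<le> m"
  shows "a i \<le> a j"
proof -
  have adjacent: "a k \<le> a (Suc k)" if "c \<le> k" "k < m" for k
    using that
  proof (induction k rule: dec_induct)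
    case base
    then show ?case using min c by simp
  next
    case (step k)
    have "Suc k \<in> {2..m - 1}" using step c by auto
    then have "2 * a (Suc k) \<le> a k + a (Suc (Suc k))"
      using convex unfolding convex_seq_def by fastforce
    with step show ?case by simp
  qed
  show ?thesis using \<open>i \<le> j\<close> \<open>j \<le> m\<close>
  proof (induction j rule: dec_induct)
    case (step j)
    then show ?case using adjacent[of j] \<open>c \<le> i\<close> by simp
  qed simp
qed

lemma convex_seq_reflect:
  assumes "convex_seq m a"
  shows "convex_seq m (\<lambda>i. a (m + 1 - i))"
  unfolding convex_seq_def
proof
  fix i assume i: "i \<in> {2..m - 1}"
  then have "m + 1 - i \<in> {2..m - 1}" by auto
  with assms have "2 * a (m + 1 - i) \<le> a (m + 1 - i - 1) + a (m + 1 - i + 1)"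
    by (simp only: convex_seq_def)
  moreover have "m + 1 - i - 1 = m + 1 - (i + 1)" "m + 1 - i + 1 = m + 1 - (i - 1)"
    using i by auto
  ultimately show "2 * a (m + 1 - i) \<le> a (m + 1 - (i - 1)) + a (m + 1 - (i + 1))" by simp
qed

lemma convex_seq_antimono_left_of_min:
  assumes convex: "convex_seq m a" and c: "c \<le> m"
    and min: "\<And>i. i \<in> {1..m} \<Longrightarrow> a c \<le> a i"
    and "1 \<le> i" "i \<le> j" "j \<le> c"
  shows "a j \<le> a i"
proof -
  let ?b = "\<lambda>k. a (m + 1 - k)"
  have min': "?b (m + 1 - c) \<le> ?b k" if "k \<in> {1..m}" for k
  proof -
    have "m + 1 - k \<in> {1..m}" using that unfolding atLeastAtMost_iff by linarith
    from min[OF this] show ?thesis using c by simp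
  qed
  have "1 \<le> m + 1 - c" "m + 1 - c \<le> m + 1 - j" "m + 1 - j \<le> m + 1 - i" "m + 1 - i \<le> m"
    using assms(2,4-6) by linarith+
  from convex_seq_mono_right_of_min[OF convex_seq_reflect[OF convex] this(1) min' this(2-4)]
  show ?thesis using assms(2,4-6) by simp
qed

section \<open>Laying out the sequences along pairs of legs\<close>

text \<open>
  Here \<open>L\<close> enumerates the legs, each listed from the hub outwards. The first half of the \<open>j\<close>-th
  sequence runs inwards along leg \<open>j\<close>, reaches the hub at index \<open>l + 1\<close>, and the second half runs
  outwards along leg \<open>n + j\<close>.
\<close>
definition join_legs :: "nat \<Rightarrow> nat \<Rightarrow> (nat \<Rightarrow> 'v list) \<Rightarrow> nat \<Rightarrow> nat \<Rightarrow> 'v" where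
  "join_legs n l L j i = (if i \<le> l + 1 then L j ! (l + 1 - i) else L (n + j) ! (i - (l + 1)))"

text \<open>
  A position on the glued legs is a leg together with a distance from the hub, and different legs
  meet only at distance zero. Hence two positions coincide only at the hub, which is the statement
  about middle terms that an embedding of the sequences asks for.
\<close>
lemma regular_spider_layout:
  assumes "regular_spider G (2 * n) l"
  obtains f where
    "{f j i | j i. j \<in> {1..n} \<and> i \<in> {1..2 * l + 1}} = pverts G"
    "\<And>j i j' i'. \<lbrakk>j \<in> {1..n}; i \<in> {1..2 * l + 1}; j' \<in> {1..n}; i' \<in> {1..2 * l + 1}\<rbrakk> \<Longrightarrow>
       f j i = f j' i' \<longleftrightarrow> (j = j' \<and> i = i') \<or> (i = l + 1 \<and> i' = l + 1)"
    "\<And>j. j \<in> {1..n} \<Longrightarrow> vpath (map (f j) [1..<2 * l + 2]) (with_proj G)"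
    "\<exists>v\<in>pverts G. degree G v = 1"
proof -
  obtain h where sp: "spider G h" and card: "card {p. leg G h p} = 2 * n"
    and len: "\<And>p. leg G h p \<Longrightarrow> vwalk_length p = l"
    using assms by (auto simp: regular_spider_def)
  have tree: "undirected_tree G" and hub: "{v \<in> pverts G. degree G v > 2} = {h}"
    using sp by (auto simp: spider_def)
  have graph: "pair_graph G" using tree by (simp add: undirected_tree_def)
  have "h \<in> pverts G" using hub by auto
  then obtain q where q: "leg G h q" using spider_vertex_on_leg[OF sp] by blast
  have leaf: "\<exists>v\<in>pverts G. degree G v = 1"
  proof
    show "degree G (last q) = 1" "last q \<in> pverts G"
      using q by (auto simp: leg_def vpath_with_proj_iff)
  qed
  have "finite {p. leg G h p}"
  proof (rule finite_subset)
    interpret pair_graph G by fact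
    show "finite {p. set p \<subseteq> pverts G \<and> length p \<le> Suc l}"
      by (rule finite_lists_length_le[OF pair_finite_verts])
    have "set p \<subseteq> pverts G \<and> length p \<le> Suc l" if "leg G h p" for p
    proof -
      have "vpath p (with_proj G)" using that by (simp add: leg_def)
      then show ?thesis using len[OF that] by (auto simp: vpath_with_proj_iff)
    qed
    then show "{p. leg G h p} \<subseteq> {p. set p \<subseteq> pverts G \<and> length p \<le> Suc l}" by blast
  qed
  then obtain L where L: "bij_betw L {1..2 * n} {p. leg G h p}"
    using ex_bij_betw_nat_finite_1 card by metis
  have leg: "leg G h (L j)" if "j \<in> {1..2 * n}" for j
    using bij_betwE[OF L] that by auto
  have path: "vpath (L j) (with_proj G)" and hd: "hd (L j) = h" if "j \<in> {1..2 * n}" for j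
    using leg[OF that] by (auto simp: leg_def)
  have length: "length (L j) = l + 1" if "j \<in> {1..2 * n}" for j
    using len[OF leg[OF that]] path[OF that] by (cases "L j") (auto simp: vpath_with_proj_iff)
  have nth_0: "L j ! 0 = h" if "j \<in> {1..2 * n}" for j
    using hd[OF that] length[OF that] by (metis Suc_eq_plus1 hd_conv_nth length_0_conv nat.distinct(1))
  have nth_inj: "L j ! i = L j ! i' \<longleftrightarrow> i = i'" if "j \<in> {1..2 * n}" "i \<le> l" "i' \<le> l" for j i i'
    using path[OF that(1)] length[OF that(1)] that(2,3)
    by (simp add: vpath_with_proj_iff nth_eq_iff_index_eq)
  have nth_eq: "L j ! i = L k ! i' \<longleftrightarrow> (j = k \<and> i = i') \<or> (i = 0 \<and> i' = 0)"
    if j: "j \<in> {1..2 * n}" and k: "k \<in> {1..2 * n}" and i: "i \<le> l" and i': "i' \<le> l" for j k i i'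
  proof (cases "j = k")
    case True
    then show ?thesis using nth_inj[OF j i i'] by auto
  next
    case False
    have "i = 0 \<and> i' = 0" if eq: "L j ! i = L k ! i'"
    proof -
      have "L j \<noteq> L k" using inj_on_eq_iff[OF bij_betw_imp_inj_on[OF L] j k] False by simp
      moreover have "L j ! i \<in> set (L j)" by (rule nth_mem) (use length[OF j] i in simp)
      moreover have "L k ! i' \<in> set (L k)" by (rule nth_mem) (use length[OF k] i' in simp)
      ultimately have "L j ! i = h"
        using spider_legs_meet_at_hub[OF sp leg[OF j] leg[OF k], of "L j ! i"] eq by simp
      then have "L j ! i = L j ! 0" "L k ! i' = L k ! 0"
        using eq nth_0[OF j] nth_0[OF k] by simp_all
      then show ?thesis using nth_inj[OF j i] nth_inj[OF k i'] by simp
    qed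
    then show ?thesis using nth_0[OF j] nth_0[OF k] False by auto
  qed
  have nth_arc: "(L j ! i, L j ! Suc i) \<in> parcs G" if "j \<in> {1..2 * n}" "i < l" for j i
    using path[OF that(1)] length[OF that(1)] that(2)
    by (auto simp: vpath_with_proj_iff successively_conv_nth)
  have nth_vert: "L j ! i \<in> pverts G" if "j \<in> {1..2 * n}" "i \<le> l" for j i
    using path[OF that(1)] length[OF that(1)] that(2)
    by (auto simp: vpath_with_proj_iff subset_iff)
  let ?f = "join_legs n l L"
  have inj: "?f j i = ?f j' i' \<longleftrightarrow> (j = j' \<and> i = i') \<or> (i = l + 1 \<and> i' = l + 1)"
    if "j \<in> {1..n}" "i \<in> {1..2 * l + 1}" "j' \<in> {1..n}" "i' \<in> {1..2 * l + 1}" for j i j' i'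
    using that by (auto simp: join_legs_def nth_eq)
  have vert: "?f j i \<in> pverts G" if "j \<in> {1..n}" "i \<in> {1..2 * l + 1}" for j i
    using that by (auto simp: join_legs_def intro!: nth_vert)
  have cover: "\<exists>j\<in>{1..n}. \<exists>i\<in>{1..2 * l + 1}. v = ?f j i" if v: "v \<in> pverts G" for v
  proof -
    obtain q where "leg G h q" "v \<in> set q" using spider_vertex_on_leg[OF sp v] .
    then obtain k where k: "k \<in> {1..2 * n}" "v \<in> set (L k)"
      using bij_betw_imp_surj_on[OF L] by (metis imageE mem_Collect_eq)
    then obtain d where d: "d \<le> l" "v = L k ! d"
      using length[OF k(1)] by (metis Suc_eq_plus1 in_set_conv_nth less_Suc_eq_le)
    show ?thesis
    proof (cases "k \<le> n")
      case True
      then have "v = ?f k (l + 1 - d)" "k \<in> {1..n}" "l + 1 - d \<in> {1..2 * l + 1}"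
        using d k by (auto simp: join_legs_def)
      then show ?thesis by blast
    next
      case False
      then have k': "k - n \<in> {1..n}" "n + (k - n) = k" using k by auto
      \<comment> \<open>At distance zero \<open>join_legs\<close> reads the hub off the other leg of the pair.\<close>
      have "v = ?f (k - n) (l + 1 + d)"
      proof (cases "d = 0")
        case True
        then show ?thesis using d k k' nth_0[of k] nth_0[of "k - n"] by (auto simp: join_legs_def)
      next
        case False
        then show ?thesis using d k' by (simp add: join_legs_def)
      qed
      moreover have "l + 1 + d \<in> {1..2 * l + 1}" using d by simp
      ultimately show ?thesis using k' by blast
    qed
  qed
  have "vpath (map (?f j) [1..<2 * l + 2]) (with_proj G)" if j: "j \<in> {1..n}" for j
  proof -
    have arc: "(?f j i, ?f j (Suc i)) \<in> parcs G" if i: "1 \<le> i" "i < 2 * l + 1" for i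
    proof (cases "i \<le> l")
      case True
      then have "Suc (l - i) = l + 1 - i" by simp
      then show ?thesis
        using nth_arc[of j "l - i"] True i j pair_graph_arcD(3)[OF graph]
        by (auto simp: join_legs_def)
    next
      case False
      have "?f j i = L (n + j) ! (i - (l + 1))"
        using False i j nth_0[of j] nth_0[of "n + j"] by (auto simp: join_legs_def)
      moreover have "?f j (Suc i) = L (n + j) ! Suc (i - (l + 1))"
        using False by (simp add: join_legs_def flip: Suc_diff_le)
      ultimately show ?thesis using nth_arc[of "n + j" "i - (l + 1)"] False i j by auto
    qed
    have "successively (\<lambda>x y. (x, y) \<in> parcs G) (map (?f j) [1..<2 * l + 2])"
      using arc by (auto simp: successively_conv_nth simp del: upt_Suc)
    moreover have "inj_on (?f j) {1..<2 * l + 2}"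
      by (rule inj_onI) (use inj[OF j _ j] in auto)
    ultimately show ?thesis
      using vert[OF j] by (auto simp: vpath_with_proj_iff distinct_map simp del: upt_Suc)
  qed
  moreover have "{?f j i | j i. j \<in> {1..n} \<and> i \<in> {1..2 * l + 1}} = pverts G"
    using vert cover by blast
  ultimately show thesis using that[of ?f] inj leaf by blast
qed

section \<open>Star-convexity of the embedded spider\<close>

theorem theorem1p7:
  fixes n l :: nat
    and a :: "nat \<Rightarrow> nat \<Rightarrow> real"
    and u :: real
    and S :: "'v pair_pre_digraph"
  assumes "n \<ge> 1" and "l \<ge> 1"
    and "\<And>j. j \<in> {1..n} \<Longrightarrow> convex_seq (2 * l + 1) (a j)"
    and "\<And>j i. j \<in> {1..n} \<Longrightarrow> i \<in> {1..2 * l + 1} \<Longrightarrow> 0 \<le> a j i"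
    and "\<And>j. j \<in> {1..n} \<Longrightarrow> a j (l + 1) = u"
    and "Min {a j i | j i. j \<in> {1..n} \<and> i \<in> {1..2 * l + 1}} = u"
    and "regular_spider S (2 * n) l"
  shows "\<exists>w f. embeds_terms n l a S w f \<and> star_convex S w"
proof -
  obtain f where cover: "{f j i | j i. j \<in> {1..n} \<and> i \<in> {1..2 * l + 1}} = pverts S"
    and inj: "\<And>j i j' i'. \<lbrakk>j \<in> {1..n}; i \<in> {1..2 * l + 1}; j' \<in> {1..n}; i' \<in> {1..2 * l + 1}\<rbrakk> \<Longrightarrow>
       f j i = f j' i' \<longleftrightarrow> (j = j' \<and> i = i') \<or> (i = l + 1 \<and> i' = l + 1)"
    and path: "\<And>j. j \<in> {1..n} \<Longrightarrow> vpath (map (f j) [1..<2 * l + 2]) (with_proj S)"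
    and leaf: "\<exists>v\<in>pverts S. degree S v = 1"
    using regular_spider_layout[OF assms(7)] by blast
  have tree: "pair_graph S" "connected (with_proj S)"
    using assms(7) by (auto simp: regular_spider_def spider_def undirected_tree_def)
  have min: "a j (l + 1) \<le> a j i" if "j \<in> {1..n}" "i \<in> {1..2 * l + 1}" for j i
  proof -
    have "finite {a j i | j i. j \<in> {1..n} \<and> i \<in> {1..2 * l + 1}}"
      by (rule finite_image_set2) simp_all
    then have "u \<le> a j i" unfolding assms(6)[symmetric] using that by (intro Min_le) blast+
    then show ?thesis using assms(5) that by simp
  qed
  \<comment> \<open>The choice is ambiguous only at the hub, and there all candidates are middle terms, equal to \<open>u\<close>.\<close>
  define w where "w v = (SOME r. \<exists>j\<in>{1..n}. \<exists>i\<in>{1..2 * l + 1}. v = f j i \<and> r = a j i)" for v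
  have w: "w (f j i) = a j i" if "j \<in> {1..n}" "i \<in> {1..2 * l + 1}" for j i
  proof -
    have "\<exists>j'\<in>{1..n}. \<exists>i'\<in>{1..2 * l + 1}. f j i = f j' i' \<and> w (f j i) = a j' i'"
      unfolding w_def by (rule someI_ex) (use that in blast)
    then show ?thesis using inj[OF that] assms(5) that by metis
  qed
  have "embeds_terms n l a S w f"
    unfolding embeds_terms_def using cover inj path w by blast
  moreover have "star_convex S w"
  proof -
    define h where "h = f 1 (l + 1)"
    have h: "h = f j (l + 1)" if "j \<in> {1..n}" for j
      using inj[of 1 "l + 1" j "l + 1"] that assms(1) by (simp add: h_def)
    have ray: "\<exists>xs. vpath xs (with_proj S) \<and> hd xs = h \<and> last xs = f j i \<and> weighted_monotone w xs"
      if j: "j \<in> {1..n}" and i: "i \<in> {1..2 * l + 1}" for j i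
    proof -
      have sub: "vpath (map (f j) [b..<c]) (with_proj S)" if "1 \<le> b" "b < c" "c \<le> 2 * l + 2" for b c
      proof -
        have "[1..<2 * l + 2] = [1..<b] @ [b..<c] @ [c..<2 * l + 2]"
          using that upt_add_eq_append[of 1 b "2 * l + 2 - b"]
            upt_add_eq_append[of b c "2 * l + 2 - c"]
          by (simp del: upt_Suc)
        then have "map (f j) [1..<2 * l + 2] =
            map (f j) [1..<b] @ map (f j) [b..<c] @ map (f j) [c..<2 * l + 2]"
          by (simp only: map_append)
        with path[OF j] have "vpath (map (f j) [1..<b] @ map (f j) [b..<c] @ map (f j) [c..<2 * l + 2])
            (with_proj S)" by simp
        then show ?thesis
          using that by (auto simp: vpath_with_proj_iff successively_append_iff simp del: upt_Suc)
      qed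
      show ?thesis
      proof (cases "l + 1 \<le> i")
        case True
        let ?xs = "map (f j) [l + 1..<Suc i]"
        have "sorted_wrt (\<le>) (map w ?xs)"
          unfolding sorted_wrt_map
        proof (rule sorted_wrt_mono_rel[OF _ sorted_wrt_upt])
          fix b c assume "b \<in> set [l + 1..<Suc i]" "c \<in> set [l + 1..<Suc i]" "b < c"
          then have bc: "l + 1 \<le> b" "b \<le> c" "c \<le> 2 * l + 1" using i by auto
          have "a j b \<le> a j c"
            by (rule convex_seq_mono_right_of_min[OF assms(3)[OF j] _ min[OF j] bc]) auto
          then show "w (f j b) \<le> w (f j c)" using w j bc by simp
        qed
        moreover have "hd ?xs = h" using True h[OF j] by (simp add: hd_map del: upt_Suc)
        moreover have "vpath ?xs (with_proj S)" by (rule sub) (use True i in auto)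
        ultimately show ?thesis
          using True by (intro exI[of _ ?xs]) (auto simp: weighted_monotone_def)
      next
        case False
        let ?xs = "rev (map (f j) [i..<l + 2])"
        have "sorted_wrt (\<ge>) (map w (map (f j) [i..<l + 2]))"
          unfolding sorted_wrt_map
        proof (rule sorted_wrt_mono_rel[OF _ sorted_wrt_upt])
          fix b c assume "b \<in> set [i..<l + 2]" "c \<in> set [i..<l + 2]" "b < c"
          then have bc: "1 \<le> b" "b \<le> c" "c \<le> l + 1" using i by auto
          have "a j c \<le> a j b"
            by (rule convex_seq_antimono_left_of_min[OF assms(3)[OF j] _ min[OF j] bc]) auto
          then show "w (f j c) \<le> w (f j b)" using w j bc by simp
        qed
        then have "sorted_wrt (\<le>) (map w ?xs)" by (simp only: rev_map[symmetric] sorted_wrt_rev)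
        moreover have "hd ?xs = h" using False h[OF j] by (simp add: hd_rev last_map)
        moreover have "last ?xs = f j i"
          using False by (simp add: last_rev hd_map del: upt_Suc)
        moreover have "vpath ?xs (with_proj S)"
          by (rule vpath_rev[OF tree(1) sub]) (use False i in auto)
        ultimately show ?thesis by (intro exI[of _ ?xs]) (auto simp: weighted_monotone_def)
      qed
    qed
    have "\<exists>xs. vpath xs (with_proj S) \<and> hd xs = h \<and> last xs = v \<and> weighted_monotone w xs"
      if "v \<in> pverts S" for v
      using that ray unfolding cover[symmetric] by blast
    moreover have "h \<in> pverts S" unfolding cover[symmetric] h_def using assms(1) by force
    moreover have "0 \<le> w v" if "v \<in> pverts S" for v
      using that w assms(4) unfolding cover[symmetric] by auto
    ultimately show ?thesis
      using tree leaf unfolding star_convex_def weighted_graph_def by blast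
  qed
  ultimately show ?thesis by blast
qed

end
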